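(* Let $w_1,w_2$ be non-negative weights on the same interval $\Delta_1=\Delta_2=[a,b]\subset\mathbb R$ such that $w_1$ is semiclassical on $[a,b]$ and $$w_2(x)=|\Pi(x)u(x)|\,w_1(x),\quad x\in[a,b],\qquad u(x)=\int_c^d\frac{U(t)}{x-t}\,dt,$$ where $u$ is semiclassical, $(a,b)\cap(c,d)=\emptyset$, $U$ is continuous and non-negative on $(c,d)$, and $\Pi$ is a polynomial with real coefficients, non-vanishing on $(a,b)\cup(c,d)$. Let $\boldsymbol n=(n_1,n_2)$ and let $P_{\boldsymbol n}$ be the Hermite–Padé polynomial, i.e. a monic polynomial of degree at most $n_1+n_2$ satisfying $$\int_a^bx^jP_{\boldsymbol n}(x)w_i(x)\,dx\begin{cases}=0,&j\le n_i-1,\\ \ne0,&j=n_i,\end{cases}\qquad i=1,2.$$ Then $P_{\boldsymbol n}$ has at least $n_1+\ell+1$ sign changes on $(a,b)$, where $$\ell=\min(n_2-1,\,n_1-m),\qquad m=\deg(\Pi),$$ while its Cauchy transform $\mathfrak C_{w_1}[P_{\boldsymbol n}]$ has at least $\ell+1$ sign changes in $(c,d)$.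
   Context: The intervals $(a,b)$ and $(c,d)$ are not assumed bounded. A weight $w$ on a real interval is called semiclassical here if its logarithmic derivative is rational, $w'/w=B/A$ with real polynomials $A$ (monic), $B$, the (finite) endpoints of the interval being zeros of $A$, $A$ having no zeros in the interior of the interval, and all moments of $w$ being finite; $w$ extends to a (multivalued) analytic function $\exp\left(\int^zB/A\right)$. For the function $u$, semiclassical means that $u'/u$ is a rational function; under these assumptions $w_2$ is also semiclassical. The Cauchy transform is $\mathfrak C_{w_1}[P](z)=\int_a^b\frac{P(t)w_1(t)}{t-z}\,dt$. *)

theory Defs
  imports "HOL-Analysis.Analysis" "HOL-Computational_Algebra.Polynomial"
begin

text \<open>
  Intervals may be unbounded, hence have endpoints in \<^typ>\<open>ereal\<close>. Pointwise conditions on weights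
  are imposed on the open interval \<^term>\<open>einterval a b\<close> only: a weight may be singular at an
  endpoint, and its value there does not matter for any integral.
\<close>

definition weight :: "ereal \<Rightarrow> ereal \<Rightarrow> (real \<Rightarrow> real) \<Rightarrow> bool" where
  "weight a b w \<longleftrightarrow>
     (\<forall>x\<in>einterval a b. 0 \<le> w x) \<and>
     (\<forall>k::nat. interval_lebesgue_integrable lborel a b (\<lambda>x. x ^ k * w x))"

text \<open>
  The logarithmic derivative of \<open>f\<close> on \<open>S\<close> is the rational function \<open>B / A\<close>. The requirements
  \<open>f x \<noteq> 0\<close> and \<open>poly A x \<noteq> 0\<close> guard against division by zero having the value zero.
\<close>

definition log_deriv_quotient :: "real set \<Rightarrow> (real \<Rightarrow> real) \<Rightarrow> real poly \<Rightarrow> real poly \<Rightarrow> bool" where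
  "log_deriv_quotient S f B A \<longleftrightarrow>
     A \<noteq> 0 \<and>
     (\<forall>x\<in>S. f differentiable (at x) \<and> f x \<noteq> 0 \<and>
            (poly A x \<noteq> 0 \<longrightarrow> deriv f x / f x = poly B x / poly A x))"

definition semiclassical_weight :: "ereal \<Rightarrow> ereal \<Rightarrow> (real \<Rightarrow> real) \<Rightarrow> bool" where
  "semiclassical_weight a b w \<longleftrightarrow>
     weight a b w \<and>
     (\<exists>A B. lead_coeff A = 1 \<and>
            log_deriv_quotient (einterval a b) w B A \<and>
            (\<forall>x. ereal x = a \<or> ereal x = b \<longrightarrow> poly A x = 0) \<and>
            (\<forall>x\<in>einterval a b. poly A x \<noteq> 0))"

definition semiclassical_function :: "real set \<Rightarrow> (real \<Rightarrow> real) \<Rightarrow> bool" where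
  "semiclassical_function S u \<longleftrightarrow> (\<exists>A B. log_deriv_quotient S u B A)"

definition orthogonal_exactly ::
    "ereal \<Rightarrow> ereal \<Rightarrow> (real \<Rightarrow> real) \<Rightarrow> nat \<Rightarrow> real poly \<Rightarrow> bool" where
  "orthogonal_exactly a b w n P \<longleftrightarrow>
     (\<forall>j<n. (LBINT x=a..b. x ^ j * poly P x * w x) = 0) \<and>
     (LBINT x=a..b. x ^ n * poly P x * w x) \<noteq> 0"

definition hermite_pade_poly ::
    "ereal \<Rightarrow> ereal \<Rightarrow> (real \<Rightarrow> real) \<Rightarrow> (real \<Rightarrow> real) \<Rightarrow> nat \<Rightarrow> nat \<Rightarrow> real poly \<Rightarrow> bool" where
  "hermite_pade_poly a b w1 w2 n1 n2 P \<longleftrightarrow>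
     lead_coeff P = 1 \<and> degree P \<le> n1 + n2 \<and>
     orthogonal_exactly a b w1 n1 P \<and> orthogonal_exactly a b w2 n2 P"

text \<open>
  Polymorphic, so that the instance at \<^typ>\<open>complex\<close> is the Cauchy transform off the interval and
  the instance at \<^typ>\<open>real\<close> is its restriction to the real line.
\<close>

definition cauchy_transform ::
    "ereal \<Rightarrow> ereal \<Rightarrow> (real \<Rightarrow> real) \<Rightarrow> real poly
     \<Rightarrow> 'a \<Rightarrow> 'a::{real_normed_field, banach, second_countable_topology}" where
  "cauchy_transform a b w P z = (LBINT t=a..b. of_real (poly P t * w t) / (of_real t - z))"

text \<open>
  At least \<open>k\<close> sign changes: strictly increasing points \<open>x 0, \<dots>, x k\<close> of \<open>S\<close> at which the values of
  \<open>f\<close> are nonzero and alternate in sign. The number \<open>k\<close> is an integer because the bounds below may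
  be negative; they are then void.
\<close>

definition at_least_sign_changes :: "int \<Rightarrow> (real \<Rightarrow> real) \<Rightarrow> real set \<Rightarrow> bool" where
  "at_least_sign_changes k f S \<longleftrightarrow>
     (\<exists>x :: nat \<Rightarrow> real.
        (\<forall>i. int i \<le> k \<longrightarrow> x i \<in> S) \<and>
        (\<forall>i. int i < k \<longrightarrow> x i < x (Suc i) \<and> f (x i) * f (x (Suc i)) < 0))"

end

theory Submission imports Defs begin

text \<open>
  The classical principle behind the theorem: a continuous function that is orthogonal to all
  polynomials of degree below \<open>k\<close> has at least \<open>k\<close> sign changes, for otherwise a polynomial of smaller
  degree would imitate its signs (\<open>few_sign_changes_imp_sign_poly\<close>, \<open>orthogonal_imp_sign_changes\<close>).
  It is applied twice, on the two intervals \<open>I = (a, b)\<close> and \<open>J = (c, d)\<close>.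

  On \<open>J\<close>: write \<open>K\<close> for the Cauchy transform of \<open>P w\<^sub>1\<close> and \<open>Q\<close> for \<open>\<Pi>\<close>. Up to a constant sign \<open>w\<^sub>2\<close> is
  \<open>Q u w\<^sub>1\<close>, so for \<open>j < n\<^sub>2\<close> the orthogonality to \<open>w\<^sub>2\<close>, after inserting the integral for \<open>u\<close> and swapping
  the integrals (\<open>cauchy_integral_swap\<close>), says that \<open>U t\<close> times
  \<open>\<integral> x\<^sup>j Q(x) P(x) w\<^sub>1(x) / (x - t) dx\<close> integrates to zero over \<open>J\<close>. As long as \<open>j + deg Q \<le> n\<^sub>1\<close>, the
  polynomial \<open>x\<^sup>j Q(x)\<close> may be replaced by its value at \<open>t\<close>: the difference is divisible by \<open>x - t\<close> with
  quotient of degree below \<open>n\<^sub>1\<close>, which \<open>P w\<^sub>1\<close> annihilates (\<open>cauchy_integral_poly_times\<close>). Hence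
  \<open>K U Q\<close> is orthogonal to \<open>t\<^sup>j\<close> for all \<open>j \<le> \<ell>\<close>, and \<open>K\<close> has \<open>\<ell> + 1\<close> sign changes because \<open>U Q\<close> has
  constant sign.

  On \<open>I\<close>: these sign changes give \<open>\<ell> + 1\<close> distinct zeros \<open>z\<close> of \<open>K\<close> in \<open>J\<close>. Each zero buys one more
  orthogonality relation when \<open>P w\<^sub>1\<close> is divided by \<open>x - z\<close> (\<open>orthogonal_divide_cauchy_zeros\<close>), so
  \<open>P w\<^sub>1 / \<Prod> (x - z)\<close> is orthogonal to all polynomials of degree at most \<open>n\<^sub>1 + \<ell>\<close>. The denominator has
  constant sign on \<open>I\<close>, whence the \<open>n\<^sub>1 + \<ell> + 1\<close> sign changes of \<open>P\<close>.

  The first application needs \<open>K U\<close> not to vanish identically. The second argument supplies this as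
  well: \<open>k\<close> zeros of \<open>K\<close> outside the closure of \<open>I\<close> force at least \<open>k\<close> sign changes of \<open>P\<close>, so there are
  at most \<open>deg P\<close> such zeros (\<open>finite_cauchy_zeros\<close>), while \<open>U\<close> is nonzero on a nonempty open set.
\<close>

section \<open>Sign changes\<close>

lemma at_least_sign_changes_nat:
  "at_least_sign_changes (int k) f S \<longleftrightarrow>
     (\<exists>x. (\<forall>i\<le>k. x i \<in> S) \<and> (\<forall>i<k. x i < x (Suc i) \<and> f (x i) * f (x (Suc i)) < 0))"
  unfolding at_least_sign_changes_def by simp

lemma at_least_sign_changes_extend:
  assumes "\<forall>i\<le>k. x i \<in> S" "\<forall>i<k. x i < x (Suc i) \<and> f (x i) * f (x (Suc i)) < 0"
    and "y \<in> S" "x k < y" "f (x k) * f y < 0"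
  shows "at_least_sign_changes (int (Suc k)) f S"
  unfolding at_least_sign_changes_nat
  by (rule exI[of _ "x(Suc k := y)"]) (use assms in \<open>auto simp: less_Suc_eq le_Suc_eq\<close>)

lemma at_least_sign_changes_mono:
  "at_least_sign_changes k f S \<Longrightarrow> k' \<le> k \<Longrightarrow> at_least_sign_changes k' f S"
  unfolding at_least_sign_changes_def by (meson order.trans order.strict_trans2)

lemma at_least_sign_changes_divide_sign:
  assumes "at_least_sign_changes k (\<lambda>x. f x * h x) S" and "\<And>x y. x \<in> S \<Longrightarrow> y \<in> S \<Longrightarrow> 0 \<le> h x * h y"
  shows "at_least_sign_changes k f S"
proof -
  obtain x where x: "\<forall>i. int i \<le> k \<longrightarrow> x i \<in> S"
    "\<forall>i. int i < k \<longrightarrow> x i < x (Suc i) \<and> f (x i) * h (x i) * (f (x (Suc i)) * h (x (Suc i))) < 0"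
    using assms(1) unfolding at_least_sign_changes_def by auto
  have "f (x i) * f (x (Suc i)) < 0" if "int i < k" for i
  proof -
    have "0 \<le> h (x i) * h (x (Suc i))" using assms(2) x(1) that by auto
    moreover have "(f (x i) * f (x (Suc i))) * (h (x i) * h (x (Suc i))) < 0"
      using x(2) that by (simp add: mult_ac)
    ultimately show ?thesis by (metis mult_less_0_iff not_le)
  qed
  with x show ?thesis unfolding at_least_sign_changes_def by auto
qed

text \<open>
  The intermediate value theorem gives a zero between consecutive alternation points. Keeping the
  first \<open>j\<close> zeros strictly below \<open>x j\<close> makes the next one new.
\<close>
lemma sign_changes_imp_zeros:
  assumes "at_least_sign_changes (int k) f S" "continuous_on S f" "is_interval S"
  shows "\<exists>Z. finite Z \<and> card Z = k \<and> Z \<subseteq> S \<and> (\<forall>z\<in>Z. f z = 0)"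
proof -
  obtain x where xS: "\<forall>i\<le>k. x i \<in> S"
    and x: "\<forall>i<k. x i < x (Suc i) \<and> f (x i) * f (x (Suc i)) < 0"
    using assms(1) unfolding at_least_sign_changes_nat by blast
  have "\<exists>Z. finite Z \<and> card Z = j \<and> Z \<subseteq> S \<inter> {..<x j} \<and> (\<forall>z\<in>Z. f z = 0)" if "j \<le> k" for j
    using that
  proof (induction j)
    case 0
    show ?case by (rule exI[of _ "{}"]) auto
  next
    case (Suc j)
    then obtain Z where Z: "finite Z" "card Z = j" "Z \<subseteq> S \<inter> {..<x j}" "\<forall>z\<in>Z. f z = 0" by auto
    have j: "x j < x (Suc j)" "f (x j) * f (x (Suc j)) < 0" using x Suc by auto
    have sub: "{x j..x (Suc j)} \<subseteq> S"
      using xS Suc assms(3) mem_is_interval_1_I[of S "x j" "x (Suc j)"] by auto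
    have cont: "continuous_on {x j..x (Suc j)} f" using assms(2) sub continuous_on_subset by blast
    have "\<exists>z. x j \<le> z \<and> z \<le> x (Suc j) \<and> f z = 0"
    proof (cases "f (x j) \<le> 0")
      case True
      then show ?thesis using IVT'[of f "x j" 0 "x (Suc j)"] cont j by (auto simp: mult_less_0_iff)
    next
      case False
      then show ?thesis using IVT2'[of f "x (Suc j)" 0 "x j"] cont j by (auto simp: mult_less_0_iff)
    qed
    then obtain z where z: "x j \<le> z" "z \<le> x (Suc j)" "f z = 0" by blast
    then have "z \<noteq> x j" "z \<noteq> x (Suc j)" using j by auto
    with z have zin: "x j < z" "z < x (Suc j)" "z \<in> S" using sub by auto
    then have "z \<notin> Z" using Z(3) by auto
    show ?case
    proof (intro exI[of _ "insert z Z"] conjI)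
      show "card (insert z Z) = Suc j" using Z \<open>z \<notin> Z\<close> by simp
      have "Z \<subseteq> S \<inter> {..<x (Suc j)}"
        using Z(3) less_trans[OF _ j(1)] by (meson Int_iff lessThan_iff subset_iff)
      then show "insert z Z \<subseteq> S \<inter> {..<x (Suc j)}" using zin by simp
      show "finite (insert z Z)" using Z(1) by (rule finite.insertI)
      show "\<forall>y\<in>insert z Z. f y = 0" using Z(4) z(3) by blast
    qed
  qed
  from this[OF order.refl] show ?thesis unfolding le_inf_iff by (elim exE conjE) (intro exI conjI)
qed

text \<open>
  The polynomial has its zeros where \<open>g\<close> changes its sign. These places are found by order alone, by
  induction on the number of sign changes: the final stretch \<open>T\<close> of \<open>S\<close> on which \<open>g\<close> keeps its last
  sign is split off, and \<open>g\<close> has one sign change less on the rest \<open>L\<close>. The last conclusion, that \<open>R\<close> is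
  nonnegative to the right of \<open>S\<close>, is what controls on \<open>T\<close> the sign of the polynomial for \<open>L\<close>.
\<close>
lemma few_sign_changes_imp_sign_poly:
  assumes "\<not> at_least_sign_changes (int (Suc k)) g S"
  shows "\<exists>\<sigma> R. \<sigma> \<in> {1, -1::real} \<and> R \<noteq> 0 \<and> degree R \<le> k \<and> (\<forall>x\<in>S. 0 \<le> \<sigma> * poly R x * g x) \<and>
           (\<forall>t. (\<forall>x\<in>S. x \<le> t) \<longrightarrow> 0 \<le> poly R t)"
  using assms
proof (induction k arbitrary: S)
  case 0
  have const: "0 \<le> g x * g y" if "x \<in> S" "y \<in> S" for x y
  proof (rule ccontr)
    assume neg: "\<not> 0 \<le> g x * g y"
    then have "x \<noteq> y" by auto
    then consider "x < y" | "y < x" by linarith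
    then show False
    proof cases
      case 1
      then show ?thesis using 0 neg that at_least_sign_changes_extend[of 0 "\<lambda>_. x" S g y] by auto
    next
      case 2
      then show ?thesis using 0 neg that at_least_sign_changes_extend[of 0 "\<lambda>_. y" S g x]
        by (auto simp: mult.commute)
    qed
  qed
  have "(\<forall>x\<in>S. 0 \<le> g x) \<or> (\<forall>x\<in>S. g x \<le> 0)"
    using const by (metis linorder_not_le mult_less_0_iff)
  then show ?case
  proof
    assume "\<forall>x\<in>S. 0 \<le> g x"
    then show ?thesis by (intro exI[of _ 1] exI[of _ "1 :: real poly"]) auto
  next
    assume "\<forall>x\<in>S. g x \<le> 0"
    then show ?thesis by (intro exI[of _ "-1"] exI[of _ "1 :: real poly"]) auto
  qed
next
  case (Suc k)
  show ?case
  proof (cases "at_least_sign_changes (int (Suc k)) g S")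
    case False
    then show ?thesis using Suc.IH[of S] le_Suc_eq by blast
  next
    case True
    then obtain x where xS: "\<forall>i\<le>Suc k. x i \<in> S"
      and x: "\<forall>i<Suc k. x i < x (Suc i) \<and> g (x i) * g (x (Suc i)) < 0"
      unfolding at_least_sign_changes_nat by blast
    define e where "e = x (Suc k)"
    define T where "T = {y \<in> S. \<forall>y'\<in>S. y \<le> y' \<longrightarrow> 0 \<le> g y' * g e}"
    define L where "L = S - T"
    have ge: "g e \<noteq> 0" using x[rule_format, of k] by (auto simp: e_def)
    have eS: "e \<in> S" using xS by (auto simp: e_def)
    have eT: "e \<in> T"
      unfolding T_def
    proof (intro CollectI conjI ballI impI eS)
      fix y' assume "y' \<in> S" "e \<le> y'"
      show "0 \<le> g y' * g e"
      proof (rule ccontr)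
        assume "\<not> 0 \<le> g y' * g e"
        moreover from this \<open>e \<le> y'\<close> have "e < y'" by (cases "e = y'") auto
        ultimately show False
          using at_least_sign_changes_extend[OF xS x \<open>y' \<in> S\<close>] Suc.prems by (simp add: e_def mult.commute)
      qed
    qed
    have LT: "y < t" if "y \<in> L" "t \<in> T" for y t
      using that unfolding L_def T_def by (auto intro!: leI dest: order.trans)
    \<comment> \<open>An alternating chain in \<open>L\<close> extends within \<open>S\<close>: either by \<open>e\<close>, if its last value has the sign
      opposite to \<open>g e\<close>, or by a later point at which \<open>g\<close> has that sign.\<close>
    have "\<not> at_least_sign_changes (int (Suc k)) g L"
    proof
      assume "at_least_sign_changes (int (Suc k)) g L"
      then obtain z where zL: "\<forall>i\<le>Suc k. z i \<in> L"
        and z: "\<forall>i<Suc k. z i < z (Suc i) \<and> g (z i) * g (z (Suc i)) < 0"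
        unfolding at_least_sign_changes_nat by blast
      define v where "v = z (Suc k)"
      have vL: "v \<in> L" using zL by (auto simp: v_def)
      have gv: "g v \<noteq> 0" using z[rule_format, of k] by (auto simp: v_def)
      have zS: "\<forall>i\<le>Suc k. z i \<in> S" using zL by (auto simp: L_def)
      obtain y where y: "y \<in> S" "v \<le> y" "g y * g e < 0"
        using vL by (auto simp: L_def T_def not_le)
      show False
      proof (cases "g v * g e < 0")
        case True
        then show ?thesis
          using at_least_sign_changes_extend[OF zS z eS] LT[OF vL eT] Suc.prems by (simp add: v_def)
      next
        case False
        with gv ge y have "g v * g y < 0"
          by (auto simp: mult_less_0_iff not_less zero_le_mult_iff)
        moreover from this y have "v < y" by (cases "v = y") auto
        ultimately show ?thesis
          using at_least_sign_changes_extend[OF zS z y(1)] Suc.prems by (simp add: v_def)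
      qed
    qed
    then obtain \<sigma>' R where R: "\<sigma>' \<in> {1, -1::real}" "R \<noteq> 0" "degree R \<le> k"
        "\<forall>x\<in>L. 0 \<le> \<sigma>' * poly R x * g x" "\<forall>t. (\<forall>x\<in>L. x \<le> t) \<longrightarrow> 0 \<le> poly R t"
      using Suc.IH by blast
    have RT: "0 \<le> poly R t" if "t \<in> T" for t
      using R(5) LT that by (meson less_imp_le)
    have gT: "0 \<le> sgn (g e) * g t" if "t \<in> T" for t
      using that ge unfolding T_def by (auto simp: sgn_if zero_le_mult_iff split: if_splits)
    have sg: "sgn (g e) \<in> {1, -1}" using ge by (auto simp: sgn_if)
    \<comment> \<open>If the sign for \<open>L\<close> already fits \<open>T\<close>, then \<open>R\<close> serves for all of \<open>S\<close>; otherwise it must change at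
      the boundary \<open>Sup L\<close> between \<open>L\<close> and \<open>T\<close>. For empty \<open>L\<close> there is no such boundary, and \<open>R\<close> is
      nonnegative everywhere.\<close>
    show ?thesis
    proof (cases "L = {} \<or> \<sigma>' = sgn (g e)")
      case True
      have "0 \<le> sgn (g e) * poly R y * g y" if "y \<in> S" for y
      proof (cases "y \<in> T")
        case t: True
        show ?thesis using mult_nonneg_nonneg[OF RT[OF t] gT[OF t]] by (simp add: mult_ac)
      next
        case False
        then show ?thesis using R(4) True that by (auto simp: L_def)
      qed
      moreover have "0 \<le> poly R t" if "\<forall>x\<in>S. x \<le> t" for t
        using R(5) that by (auto simp: L_def)
      ultimately show ?thesis using R(2,3) sg by (intro exI[of _ "sgn (g e)"] exI[of _ R]) auto
    next
      case False
      define r where "r = Sup L"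
      have bdd: "bdd_above L" using LT eT by (meson bdd_aboveI less_imp_le)
      have Lr: "y \<le> r" if "y \<in> L" for y unfolding r_def using that bdd by (rule cSup_upper)
      have rT: "r \<le> t" if "\<forall>y\<in>L. y \<le> t" for t
        unfolding r_def using False that by (intro cSup_least) auto
      define R' where "R' = [:-r, 1:] * R"
      have p: "poly R' y = (y - r) * poly R y" for y unfolding R'_def by (simp add: algebra_simps)
      have neg: "sgn (g e) = - \<sigma>'" using False R(1) sg by auto
      have "0 \<le> sgn (g e) * poly R' y * g y" if "y \<in> S" for y
      proof (cases "y \<in> T")
        case t: True
        have "0 \<le> (y - r) * (poly R y * (sgn (g e) * g y))"
          using rT[of y] LT[OF _ t]
          by (intro mult_nonneg_nonneg[OF _ mult_nonneg_nonneg[OF RT[OF t] gT[OF t]]]) (auto simp: less_imp_le)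
        then show ?thesis by (simp add: p mult_ac)
      next
        case False
        then have "y \<in> L" using that by (auto simp: L_def)
        then have "0 \<le> (r - y) * (\<sigma>' * poly R y * g y)"
          using Lr R(4) by (intro mult_nonneg_nonneg[of "r - y"]) auto
        then show ?thesis by (simp add: p neg algebra_simps)
      qed
      moreover have "0 \<le> poly R' t" if "\<forall>x\<in>S. x \<le> t" for t
        using R(5) that rT[of t] unfolding p L_def by (intro mult_nonneg_nonneg) auto
      moreover have "R' \<noteq> 0" "degree R' \<le> Suc k"
        using R(2,3) unfolding R'_def by (auto simp: degree_mult_eq simp del: mult_pCons_left)
      ultimately show ?thesis using sg by (intro exI[of _ "sgn (g e)"] exI[of _ R']) auto
    qed
  qed
qed

lemma nonvanishing_imp_constant_sign:
  fixes f :: "real \<Rightarrow> real"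
  assumes S: "is_interval S" and f: "continuous_on S f" "\<forall>x\<in>S. f x \<noteq> 0" and xy: "x \<in> S" "y \<in> S"
  shows "0 < f x * f y"
proof (rule ccontr)
  assume "\<not> 0 < f x * f y"
  then have "f x \<le> 0 \<and> 0 \<le> f y \<or> f y \<le> 0 \<and> 0 \<le> f x"
    by (auto simp: not_less mult_le_0_iff)
  moreover have "is_interval (f ` S)"
    using S f(1) connected_continuous_image is_interval_connected_1 by blast
  ultimately have "0 \<in> f ` S" using xy
    by (auto intro: mem_is_interval_1_I[of "f ` S" "f x" "f y"] mem_is_interval_1_I[of "f ` S" "f y" "f x"])
  then show False using f(2) by auto
qed

section \<open>Orthogonality forces sign changes\<close>

text \<open>
  The zero polynomial is admitted separately because its degree \<open>0\<close> is not below \<open>k = 0\<close>; it arises as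
  a quotient of a division by \<open>x - z\<close>.
\<close>
lemma set_integrable_poly_times:
  fixes g :: "real \<Rightarrow> real"
  assumes "\<And>j. j < k \<Longrightarrow> set_integrable M I (\<lambda>x. x ^ j * g x)" "R = 0 \<or> degree R < k"
  shows "set_integrable M I (\<lambda>x. poly R x * g x)"
    "(LINT x:I|M. poly R x * g x) = (\<Sum>j\<le>degree R. coeff R j * (LINT x:I|M. x ^ j * g x))"
proof -
  have *: "integrable M (\<lambda>x. coeff R j * (indicator I x * (x ^ j * g x)))" if "j \<in> {..degree R}" for j
  proof (cases "R = 0")
    case False
    then have "j < k" using assms(2) that by auto
    then show ?thesis using assms(1)[of j] unfolding set_integrable_def by simp
  qed simp
  have eq: "(\<lambda>x. indicator I x *\<^sub>R (poly R x * g x)) =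
        (\<lambda>x. \<Sum>j\<le>degree R. coeff R j * (indicator I x * (x ^ j * g x)))"
    by (auto simp: poly_altdef sum_distrib_right sum_distrib_left mult_ac)
  show "set_integrable M I (\<lambda>x. poly R x * g x)"
    unfolding set_integrable_def eq using * by (rule Bochner_Integration.integrable_sum)
  show "(LINT x:I|M. poly R x * g x) = (\<Sum>j\<le>degree R. coeff R j * (LINT x:I|M. x ^ j * g x))"
    unfolding set_lebesgue_integral_def eq using * by (subst Bochner_Integration.integral_sum) auto
qed

text \<open>
  With fewer sign changes there would be a polynomial \<open>R\<close> of degree below \<open>k\<close> with \<open>\<plusminus> R g \<ge> 0\<close>. By
  orthogonality this product has integral zero, so it vanishes almost everywhere, and so does \<open>g\<close>,
  because \<open>R\<close> has finitely many zeros. But the set where \<open>g\<close> is nonzero is open and nonempty.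
\<close>
lemma orthogonal_imp_sign_changes:
  fixes g :: "real \<Rightarrow> real"
  assumes "open I" "continuous_on I g" "\<exists>x\<in>I. g x \<noteq> 0"
    and int: "\<And>j. j < k \<Longrightarrow> set_integrable lborel I (\<lambda>x. x ^ j * g x)"
    and orth: "\<And>j. j < k \<Longrightarrow> (LINT x:I|lborel. x ^ j * g x) = 0"
  shows "at_least_sign_changes (int k) g I"
proof (cases k)
  case 0
  then show ?thesis using assms(3) unfolding at_least_sign_changes_nat by auto
next
  case (Suc n)
  show ?thesis
  proof (rule ccontr)
    assume "\<not> ?thesis"
    then obtain \<sigma> R where R: "\<sigma> \<in> {1, -1::real}" "R \<noteq> 0" "degree R \<le> n" "\<forall>x\<in>I. 0 \<le> \<sigma> * poly R x * g x"
      using few_sign_changes_imp_sign_poly[of n g I] Suc by blast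
    have deg: "R = 0 \<or> degree R < k" using R Suc by auto
    have zero: "(LINT x:I|lborel. poly R x * g x) = 0"
      using set_integrable_poly_times(2)[OF int deg] orth R(3) Suc by simp
    have integ: "integrable lborel (\<lambda>x. indicator I x * (\<sigma> * poly R x * g x))"
      using set_integrable_mult_right[OF set_integrable_poly_times(1)[OF int deg], of \<sigma>]
      unfolding set_integrable_def by (simp add: mult_ac)
    have "(LINT x|lborel. indicator I x * (\<sigma> * poly R x * g x)) = \<sigma> * (LINT x:I|lborel. poly R x * g x)"
      unfolding set_lebesgue_integral_def by (subst integral_mult_right_zero[symmetric]) (simp add: mult_ac)
    then have "AE x in lborel. indicator I x * (\<sigma> * poly R x * g x) = 0"
      using integral_nonneg_eq_0_iff_AE[OF integ] R(4) zero by (auto simp: indicator_def)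
    moreover have "AE x in lborel. x \<notin> {x. poly R x = 0}"
      using poly_roots_finite[OF R(2)] by (intro AE_not_in finite_imp_null_set_lborel)
    ultimately have ae: "AE x in lborel. x \<notin> {x \<in> I. g x \<noteq> 0}"
      by eventually_elim (use R(1) in auto)
    have op: "open {x \<in> I. g x \<noteq> 0}"
      using continuous_open_preimage[OF assms(2,1), of "-{0}"] by (simp add: vimage_def Int_def open_Compl)
    have "{x \<in> I. g x \<noteq> 0} \<in> null_sets lborel"
      using ae op by (subst AE_iff_null_sets) auto
    then have "negligible {x \<in> I. g x \<noteq> 0}"
      by (simp add: negligible_iff_null_sets null_sets_completionI)
    then show False using open_not_negligible[OF op] assms(3) by blast
  qed
qed

section \<open>Cauchy transforms of orthogonal functions\<close>

lemma set_integrable_divide_away: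
  fixes f :: "real \<Rightarrow> real"
  assumes f: "set_integrable lborel I f" and z: "z \<notin> closure I"
  shows "set_integrable lborel I (\<lambda>x. f x / (x - z))"
proof -
  obtain d where d: "d > 0" "\<And>x. x \<in> I \<Longrightarrow> d \<le> \<bar>x - z\<bar>"
    using z unfolding closure_approachable dist_real_def by (meson not_less)
  show ?thesis
  proof (rule set_integrable_bound)
    show "set_integrable lborel I (\<lambda>x. f x / d)" using f by auto
    have [measurable]: "(\<lambda>x. indicator I x * f x) \<in> borel_measurable lborel"
      using f unfolding set_integrable_def by auto
    have "(\<lambda>x. (indicator I x * f x) / (x - z)) \<in> borel_measurable lborel" by measurable
    then show "set_borel_measurable lborel I (\<lambda>x. f x / (x - z))"
      unfolding set_borel_measurable_def by simp
    show "AE x in lborel. x \<in> I \<longrightarrow> norm (f x / (x - z)) \<le> norm (f x / d)"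
      using d by (auto intro!: AE_I2 frac_le simp: abs_divide)
  qed
qed

lemma set_integrable_divide_prod_away:
  fixes f :: "real \<Rightarrow> real"
  assumes "finite Z" "set_integrable lborel I f" "\<forall>z\<in>Z. z \<notin> closure I"
  shows "set_integrable lborel I (\<lambda>x. f x / (\<Prod>z\<in>Z. x - z))"
  using assms(1,3)
proof induction
  case empty
  then show ?case using assms(2) by simp
next
  case (insert z Z)
  then have "set_integrable lborel I (\<lambda>x. f x / (\<Prod>z\<in>Z. x - z) / (x - z))"
    by (intro set_integrable_divide_away) auto
  with insert show ?case by (simp add: mult.commute)
qed

text \<open>
  Dominated convergence: a convergent sequence together with its limit is a compact subset of \<open>J\<close> and
  therefore keeps a positive distance \<open>d\<close> from the closure of \<open>I\<close>, so \<open>\<bar>g\<bar> / d\<close> dominates.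
\<close>
lemma continuous_on_cauchy_integral:
  fixes g :: "real \<Rightarrow> real"
  assumes g: "set_integrable lborel I g" and J: "open J" "I \<inter> J = {}"
  shows "continuous_on J (\<lambda>z. LINT x:I|lborel. g x / (x - z))"
  unfolding continuous_on_sequentially comp_def
proof (intro allI ballI impI; elim conjE)
  fix s :: "nat \<Rightarrow> real" and z assume z: "z \<in> J" and s: "\<forall>n. s n \<in> J" "s \<longlonglongrightarrow> z"
  have "closure I \<inter> J = {}" using J by (simp add: Int_commute open_Int_closure_eq_empty)
  then have "insert z (range s) \<inter> closure I = {}" using z s by auto
  then obtain d where d: "d > 0" "\<forall>y\<in>insert z (range s). \<forall>x\<in>closure I. d \<le> dist y x"
    using separate_compact_closed[OF compact_sequence_with_limit[OF s(2)] closed_closure] by blast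
  have d': "d \<le> \<bar>x - s n\<bar>" "d \<le> \<bar>x - z\<bar>" if "x \<in> I" for x n
    using d(2) that closure_subset[of I] by (auto simp: dist_real_def abs_minus_commute subset_iff)
  have [measurable]: "(\<lambda>x. indicator I x * g x) \<in> borel_measurable lborel"
    using g unfolding set_integrable_def by auto
  have m: "(\<lambda>x. (indicator I x * g x) / (x - y)) \<in> borel_measurable lborel" for y by measurable
  show "(\<lambda>n. LINT x:I|lborel. g x / (x - s n)) \<longlonglongrightarrow> (LINT x:I|lborel. g x / (x - z))"
    unfolding set_lebesgue_integral_def
  proof (rule integral_dominated_convergence[where w = "\<lambda>x. \<bar>indicator I x * g x\<bar> / d"])
    show "integrable lborel (\<lambda>x. \<bar>indicator I x * g x\<bar> / d)"
      using g unfolding set_integrable_def by simp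
    show "AE x in lborel. (\<lambda>n. indicator I x *\<^sub>R (g x / (x - s n))) \<longlonglongrightarrow> indicator I x *\<^sub>R (g x / (x - z))"
    proof (rule AE_I2)
      fix x show "(\<lambda>n. indicator I x *\<^sub>R (g x / (x - s n))) \<longlonglongrightarrow> indicator I x *\<^sub>R (g x / (x - z))"
      proof (cases "x \<in> I")
        case True
        then have "x - z \<noteq> 0" using d'(2)[OF True] d(1) by auto
        then show ?thesis by (intro tendsto_intros s(2))
      qed simp
    qed
    show "AE x in lborel. norm (indicator I x *\<^sub>R (g x / (x - s n))) \<le> \<bar>indicator I x * g x\<bar> / d" for n
    proof (rule AE_I2)
      fix x show "norm (indicator I x *\<^sub>R (g x / (x - s n))) \<le> \<bar>indicator I x * g x\<bar> / d"
      proof (cases "x \<in> I")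
        case True
        then show ?thesis using d'(1)[OF True, of n] d(1) by (auto simp: abs_divide intro!: frac_le)
      qed simp
    qed
  qed (use m in simp_all)
qed

text \<open>
  The difference \<open>(R(x) - R(z)) / (x - z)\<close> is a polynomial of degree below \<open>n\<close> and integrates to zero
  against \<open>g\<close>.
\<close>
lemma cauchy_integral_poly_times:
  fixes g :: "real \<Rightarrow> real"
  assumes I: "I \<in> sets lborel" "z \<notin> I"
    and int: "\<And>j. j < n \<Longrightarrow> set_integrable lborel I (\<lambda>x. x ^ j * g x)"
    and intz: "set_integrable lborel I (\<lambda>x. g x / (x - z))"
    and orth: "\<And>j. j < n \<Longrightarrow> (LINT x:I|lborel. x ^ j * g x) = 0"
    and deg: "degree R \<le> n"
  shows "(LINT x:I|lborel. poly R x * g x / (x - z)) = poly R z * (LINT x:I|lborel. g x / (x - z))"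
proof -
  have "poly (R - [:poly R z:]) z = 0" by simp
  then obtain q where q: "R - [:poly R z:] = [:-z, 1:] * q" using poly_eq_0_iff_dvd by blast
  then have R: "R = [:-z, 1:] * q + [:poly R z:]" by (simp add: diff_eq_eq)
  have degq: "q = 0 \<or> degree q < n"
  proof (cases "q = 0")
    case False
    have "degree ([:-z, 1:] * q) = Suc (degree q)" using False by (subst degree_mult_eq) auto
    moreover have "degree (R - [:poly R z:]) \<le> n" using deg by (intro degree_diff_le) auto
    ultimately show ?thesis using q by simp
  qed simp
  have "(LINT x:I|lborel. poly R x * g x / (x - z))
      = (LINT x:I|lborel. poly q x * g x + poly R z * (g x / (x - z)))"
  proof (rule set_lebesgue_integral_cong[OF I(1)], intro allI impI)
    fix x assume "x \<in> I"
    then have "x - z \<noteq> 0" using I(2) by auto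
    moreover have "poly R x = (x - z) * poly q x + poly R z" by (subst R) (simp add: algebra_simps)
    ultimately show "poly R x * g x / (x - z) = poly q x * g x + poly R z * (g x / (x - z))"
      by (simp add: add_divide_distrib distrib_right)
  qed
  also have "\<dots> = (LINT x:I|lborel. poly q x * g x) + poly R z * (LINT x:I|lborel. g x / (x - z))"
    using set_integrable_poly_times(1)[OF int degq] intz
    by (subst set_integral_add(2)) (auto simp del: times_divide_eq_right)
  also have "(LINT x:I|lborel. poly q x * g x) = 0"
    using set_integrable_poly_times(2)[OF int degq] orth degq by auto
  finally show ?thesis by simp
qed

text \<open>
  Induction on \<open>Z\<close>. Let \<open>G\<close> be \<open>g\<close> divided by \<open>p(x) = \<Prod> (x - y)\<close> over the zeros treated so far. The integral
  of \<open>p G / (x - z) = g / (x - z)\<close> is zero and, by orthogonality of \<open>G\<close>, equals \<open>p(z)\<close> times the integral of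
  \<open>G / (x - z)\<close>. So the Cauchy transform of \<open>G\<close> vanishes at \<open>z\<close> too, and the same replacement of a polynomial
  by its value at \<open>z\<close> shows that \<open>G / (x - z)\<close> annihilates all polynomials of degree one higher than
  \<open>G\<close> did.
\<close>
lemma orthogonal_divide_cauchy_zeros:
  fixes g :: "real \<Rightarrow> real"
  assumes I: "I \<in> sets lborel"
    and int: "\<And>j. set_integrable lborel I (\<lambda>x. x ^ j * g x)"
    and orth: "\<And>j. j < n \<Longrightarrow> (LINT x:I|lborel. x ^ j * g x) = 0"
    and Z: "finite Z" "\<forall>z\<in>Z. z \<notin> closure I \<and> (LINT x:I|lborel. g x / (x - z)) = 0"
    and j: "j < n + card Z"
  shows "(LINT x:I|lborel. x ^ j * (g x / (\<Prod>z\<in>Z. x - z))) = 0"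
  using Z j
proof (induction arbitrary: j)
  case empty
  then show ?case using orth by simp
next
  case (insert z Z)
  let ?G = "\<lambda>x. g x / (\<Prod>y\<in>Z. x - y)"
  define p where "p = (\<Prod>y\<in>Z. [:-y, 1:])"
  have p: "poly p x = (\<Prod>y\<in>Z. x - y)" for x unfolding p_def by (simp add: poly_prod)
  have degp: "degree p = card Z" unfolding p_def by (subst degree_prod_sum_eq) auto
  have z: "z \<notin> I" "z \<notin> closure I" using insert closure_subset by auto
  have ZI: "x \<notin> Z" if "x \<in> I" for x using that insert closure_subset by auto
  have intG: "set_integrable lborel I (\<lambda>x. x ^ i * ?G x)" for i
    using set_integrable_divide_prod_away[OF insert(1) int[of i]] insert(4) by simp
  have orthG: "(LINT x:I|lborel. x ^ i * ?G x) = 0" if "i < n + card Z" for i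
    using insert.IH insert.prems(1) that by simp
  have intz: "set_integrable lborel I (\<lambda>x. ?G x / (x - z))"
    using intG[of 0] z(2) by (intro set_integrable_divide_away) simp_all
  note times = cauchy_integral_poly_times[OF I z(1) intG intz orthG, of "n + card Z"]
  have "poly p z * (LINT x:I|lborel. ?G x / (x - z)) = (LINT x:I|lborel. poly p x * ?G x / (x - z))"
    using times[of p] degp by simp
  also have "\<dots> = (LINT x:I|lborel. g x / (x - z))"
    using ZI insert(1) by (intro set_lebesgue_integral_cong[OF I]) (auto simp: p)
  also have "\<dots> = 0" using insert.prems by simp
  finally have G0: "(LINT x:I|lborel. ?G x / (x - z)) = 0"
    using insert(1,2) by (auto simp: p)
  have "(LINT x:I|lborel. poly (monom 1 j) x * ?G x / (x - z)) = 0"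
    using times[of "monom 1 j"] G0 insert by (simp add: degree_monom_eq)
  then show ?case using insert(1,2) by (simp add: poly_monom mult_ac)
qed

text \<open>
  Dividing \<open>P w\<close> by \<open>\<Prod> (x - z)\<close> adds one orthogonality relation for each zero \<open>z\<close>. It alters the signs of
  \<open>P\<close> at most globally, since the points \<open>z\<close> lie off the interval \<open>I\<close>.
\<close>
lemma cauchy_zeros_imp_sign_changes:
  fixes w :: "real \<Rightarrow> real"
  assumes I: "open I" "is_interval I" "I \<noteq> {}"
    and w: "continuous_on I w" "\<forall>x\<in>I. 0 < w x"
    and int: "\<And>j. set_integrable lborel I (\<lambda>x. x ^ j * w x)"
    and P: "P \<noteq> 0"
    and orth: "\<And>j. j < n \<Longrightarrow> (LINT x:I|lborel. x ^ j * (poly P x * w x)) = 0"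
    and Z: "finite Z" "\<forall>z\<in>Z. z \<notin> closure I \<and> (LINT x:I|lborel. poly P x * w x / (x - z)) = 0"
  shows "at_least_sign_changes (int (n + card Z)) (poly P) I"
proof -
  define h where "h = (\<lambda>x. w x / (\<Prod>z\<in>Z. x - z))"
  have ZI: "x \<notin> Z" if "x \<in> I" for x using that Z closure_subset by auto
  have intP: "set_integrable lborel I (\<lambda>x. x ^ j * (poly P x * w x))" for j
    using set_integrable_poly_times(1)[of "Suc (degree (monom 1 j * P))" lborel I w "monom 1 j * P", OF int]
    by (simp add: poly_monom mult_ac)
  have "at_least_sign_changes (int (n + card Z)) (\<lambda>x. poly P x * h x) I"
  proof (rule orthogonal_imp_sign_changes)
    show "continuous_on I (\<lambda>x. poly P x * h x)"
      unfolding h_def using Z(1) ZI by (intro continuous_intros w) auto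
    have "infinite I" using I finite_imp_not_open by blast
    then have "\<not> I \<subseteq> {x. poly P x = 0}" using poly_roots_finite[OF P] finite_subset by blast
    then obtain x where "x \<in> I" "poly P x \<noteq> 0" by blast
    then show "\<exists>x\<in>I. poly P x * h x \<noteq> 0" using w(2) ZI Z(1) by (intro bexI[of _ x]) (auto simp: h_def)
    fix j
    show "set_integrable lborel I (\<lambda>x. x ^ j * (poly P x * h x))"
      using set_integrable_divide_prod_away[OF Z(1) intP[of j]] Z(2) by (simp add: h_def)
    assume "j < n + card Z"
    then show "(LINT x:I|lborel. x ^ j * (poly P x * h x)) = 0"
      using orthogonal_divide_cauchy_zeros[OF _ intP orth Z] I(1) by (simp add: h_def)
  qed (rule I(1))
  then show ?thesis
  proof (rule at_least_sign_changes_divide_sign)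
    fix x y assume xy: "x \<in> I" "y \<in> I"
    have "0 < (x - z) * (y - z)" if "z \<in> Z" for z
    proof -
      have "z \<notin> I" using ZI that by blast
      then have "\<not> (x \<le> z \<and> z \<le> y)" "\<not> (y \<le> z \<and> z \<le> x)"
        using xy I(2) mem_is_interval_1_I by blast+
      then show ?thesis by (auto simp: zero_less_mult_iff)
    qed
    then have "0 < (\<Prod>z\<in>Z. (x - z) * (y - z))" by (intro prod_pos) auto
    then have "0 \<le> (w x * w y) / (\<Prod>z\<in>Z. (x - z) * (y - z))"
      using w(2) xy by (intro divide_nonneg_pos mult_nonneg_nonneg) (auto intro: less_imp_le)
    then show "0 \<le> h x * h y" by (simp add: h_def prod.distrib)
  qed
qed

text \<open>
  The previous lemma with \<open>n = 0\<close> turns \<open>deg P + 1\<close> zeros of the transform into as many sign changes of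
  \<open>P\<close>, which would be too many zeros of \<open>P\<close>.
\<close>
lemma finite_cauchy_zeros:
  fixes w :: "real \<Rightarrow> real"
  assumes I: "open I" "is_interval I" "I \<noteq> {}"
    and w: "continuous_on I w" "\<forall>x\<in>I. 0 < w x"
    and int: "\<And>j. set_integrable lborel I (\<lambda>x. x ^ j * w x)"
    and P: "P \<noteq> 0"
  shows "finite {z. z \<notin> closure I \<and> (LINT x:I|lborel. poly P x * w x / (x - z)) = 0}" (is "finite ?N")
proof (rule ccontr)
  assume "infinite ?N"
  then obtain Z where Z: "Z \<subseteq> ?N" "finite Z" "card Z = Suc (degree P)"
    using infinite_arbitrarily_large by blast
  have "at_least_sign_changes (int (0 + card Z)) (poly P) I"
    using Z by (intro cauchy_zeros_imp_sign_changes[where w = w] assms) auto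
  moreover have "continuous_on I (poly P)" by (intro continuous_at_imp_continuous_on) simp
  ultimately obtain Y where Y: "finite Y" "card Y = Suc (degree P)" "Y \<subseteq> I" "\<forall>z\<in>Y. poly P z = 0"
    using sign_changes_imp_zeros[of "card Z" "poly P" I] I(2) Z(3) by auto
  have "card Y \<le> card {x. poly P x = 0}" using Y poly_roots_finite[OF P] by (intro card_mono) auto
  also have "\<dots> \<le> degree P" by (rule card_poly_roots_bound[OF P])
  finally show False using Y(2) by simp
qed

text \<open>
  Fubini. Since \<open>x - t\<close> has constant sign for \<open>t\<close> in the interval \<open>J\<close> and \<open>U\<close> is nonnegative, the inner
  integral of the absolute value is the absolute value of the inner integral; so absolute
  integrability on the product follows from integrability of the iterated integral.
\<close>
lemma cauchy_integral_swap:
  fixes h U :: "real \<Rightarrow> real"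
  assumes I: "open I" and J: "open J" "is_interval J" and IJ: "I \<inter> J = {}"
    and h: "continuous_on I h" and U: "continuous_on J U" "\<forall>t\<in>J. 0 \<le> U t"
    and intU: "\<forall>x\<in>I. set_integrable lborel J (\<lambda>t. U t / (x - t))"
    and inth: "set_integrable lborel I (\<lambda>x. h x * (LINT t:J|lborel. U t / (x - t)))"
  shows "set_integrable lborel J (\<lambda>t. U t * (LINT x:I|lborel. h x / (x - t)))"
    and "(LINT t:J|lborel. U t * (LINT x:I|lborel. h x / (x - t)))
       = (LINT x:I|lborel. h x * (LINT t:J|lborel. U t / (x - t)))"
proof -
  define F where "F = (\<lambda>x t. (indicator I x * h x) * (indicator J t * U t) / (x - t))"
  have [measurable]: "(\<lambda>x. indicator I x * h x) \<in> borel_measurable borel"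
    "(\<lambda>x. indicator J x * U x) \<in> borel_measurable borel"
    using borel_measurable_continuous_on_indicator[OF _ h] borel_measurable_continuous_on_indicator[OF _ U(1)]
      I J(1) by auto
  have meas: "case_prod F \<in> borel_measurable (lborel \<Otimes>\<^sub>M lborel)"
    unfolding F_def by measurable
  have Fx: "(LINT t|lborel. F x t) = indicator I x *\<^sub>R (h x * (LINT t:J|lborel. U t / (x - t)))" for x
  proof -
    have "(LINT t|lborel. F x t) = (LINT t|lborel. indicator I x * h x * (indicator J t *\<^sub>R (U t / (x - t))))"
      by (simp add: F_def)
    also have "\<dots> = indicator I x * h x * (LINT t:J|lborel. U t / (x - t))"
      unfolding set_lebesgue_integral_def by (rule integral_mult_right_zero)
    finally show ?thesis by simp
  qed
  have Ft: "(LINT x|lborel. F x t) = indicator J t *\<^sub>R (U t * (LINT x:I|lborel. h x / (x - t)))" for t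
  proof -
    have "(LINT x|lborel. F x t) = (LINT x|lborel. indicator J t * U t * (indicator I x *\<^sub>R (h x / (x - t))))"
      by (simp add: F_def mult_ac)
    also have "\<dots> = indicator J t * U t * (LINT x:I|lborel. h x / (x - t))"
      unfolding set_lebesgue_integral_def by (rule integral_mult_right_zero)
    finally show ?thesis by simp
  qed
  have norm: "(LINT t|lborel. norm (F x t)) = norm (LINT t|lborel. F x t)" for x
  proof -
    have "\<exists>s\<in>{1, -1}. \<forall>t. norm (F x t) = s * F x t"
    proof (cases "x \<in> I")
      case False
      then show ?thesis by (auto simp: F_def)
    next
      case True
      then have "x \<notin> J" using IJ by auto
      then have "(\<forall>t\<in>J. x < t) \<or> (\<forall>t\<in>J. t < x)"
        using J(2) mem_is_interval_1_I by (metis linorder_le_cases not_less)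
      then have "\<exists>s\<in>{1, -1}. \<forall>t\<in>J. \<bar>x - t\<bar> = s * (x - t)" by force
      then obtain s where s: "s \<in> {1, -1}" "\<forall>t\<in>J. \<bar>x - t\<bar> = s * (x - t)" by blast
      have s2: "1 / s = s" using s(1) by auto
      have "norm (F x t) = sgn (h x) * s * F x t" for t
      proof (cases "t \<in> J")
        case False then show ?thesis by (simp add: F_def)
      next
        case t: True
        have "norm (F x t) = \<bar>h x\<bar> * U t / \<bar>x - t\<bar>"
          using True t U(2) by (simp add: F_def abs_mult abs_divide)
        also have "\<dots> = (sgn (h x) * h x) * U t / (s * (x - t))" using s(2) t by (simp add: abs_sgn mult_ac)
        also have "\<dots> = sgn (h x) * (1 / s) * F x t" using True t by (simp add: F_def)
        finally show ?thesis by (simp only: s2)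
      qed
      then show ?thesis using s(1)
      proof (cases "h x = 0")
        case True then show ?thesis by (auto simp: F_def)
      next
        case False
        assume *: "\<And>t. norm (F x t) = sgn (h x) * s * F x t"
        have "sgn (h x) * s \<in> {1, -1}" using False s(1) by (auto simp: sgn_if)
        with * show ?thesis by blast
      qed
    qed
    then obtain s where s: "s \<in> {1, -1}" "\<And>t. norm (F x t) = s * F x t" by blast
    have "(LINT t|lborel. norm (F x t)) = s * (LINT t|lborel. F x t)"
      unfolding s(2) by (rule integral_mult_right_zero)
    moreover have "0 \<le> (LINT t|lborel. norm (F x t))" by simp
    ultimately show ?thesis using s(1) by auto
  qed
  have "integrable (lborel \<Otimes>\<^sub>M lborel) (case_prod F)"
  proof (rule lborel_pair.Fubini_integrable[OF meas])
    show "integrable lborel (\<lambda>x. LINT t|lborel. norm (case (x, t) of (x, t) \<Rightarrow> F x t))"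
      using inth unfolding set_integrable_def by (simp only: prod.case norm Fx) (rule integrable_norm)
    show "AE x in lborel. integrable lborel (\<lambda>t. case (x, t) of (x, t) \<Rightarrow> F x t)"
    proof (rule AE_I2)
      fix x
      show "integrable lborel (\<lambda>t. case (x, t) of (x, t) \<Rightarrow> F x t)"
      proof (cases "x \<in> I")
        case True
        then show ?thesis using intU integrable_mult_right[of "h x" lborel "\<lambda>t. indicator J t *\<^sub>R (U t / (x - t))"]
          unfolding set_integrable_def F_def by (simp add: mult_ac)
      qed (simp add: F_def)
    qed
  qed
  note int = this
  show "set_integrable lborel J (\<lambda>t. U t * (LINT x:I|lborel. h x / (x - t)))"
    using lborel_pair.integrable_snd[OF int] unfolding set_integrable_def Ft .
  show "(LINT t:J|lborel. U t * (LINT x:I|lborel. h x / (x - t)))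
       = (LINT x:I|lborel. h x * (LINT t:J|lborel. U t / (x - t)))"
    using lborel_pair.Fubini_integral[OF int] unfolding Ft Fx set_lebesgue_integral_def[symmetric] .
qed

section \<open>Sign changes of Hermite-Pade polynomials\<close>

lemma is_interval_einterval: "is_interval (einterval a b)"
proof -
  have "a < ereal x" if "a < ereal p" "p \<le> x" for p x
    using less_le_trans[of a "ereal p" "ereal x"] that by simp
  moreover have "ereal x < b" if "ereal q < b" "x \<le> q" for q x
    using le_less_trans[of "ereal x" "ereal q" b] that by simp
  ultimately show ?thesis unfolding is_interval_1 Ball_def einterval_iff by blast
qed

theorem proposition5p14:
  fixes a b c d :: ereal
    and w1 w2 u U :: "real \<Rightarrow> real"
    and Q P :: "real poly"
    and n1 n2 :: nat
  assumes "a < b" and "c < d"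
    and "einterval a b \<inter> einterval c d = {}"
    and "semiclassical_weight a b w1"
    and "weight a b w2"
    and "continuous_on (einterval c d) U"
    and "\<forall>t\<in>einterval c d. 0 \<le> U t"
    and "\<forall>x\<in>einterval a b. interval_lebesgue_integrable lborel c d (\<lambda>t. U t / (x - t))"
    and "\<forall>x\<in>einterval a b. u x = (LBINT t=c..d. U t / (x - t))"
    and "semiclassical_function (einterval a b) u"
    and "\<forall>x\<in>einterval a b \<union> einterval c d. poly Q x \<noteq> 0"
    and "\<forall>x\<in>einterval a b. w2 x = \<bar>poly Q x * u x\<bar> * w1 x"
    and "hermite_pade_poly a b w1 w2 n1 n2 P"
  shows "let m = int (degree Q);
             l = min (int n2 - 1) (int n1 - m)
         in at_least_sign_changes (int n1 + l + 1) (poly P) (einterval a b) \<and>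
            at_least_sign_changes (l + 1) (cauchy_transform a b w1 P) (einterval c d)"
proof -
  define I where "I = einterval a b"
  define J where "J = einterval c d"
  define K where "K = (\<lambda>z. LINT x:I|lborel. poly P x * w1 x / (x - z))"
  define l where "l = min (int n2 - 1) (int n1 - int (degree Q))"
  \<comment> \<open>Truncation covers the case \<open>l + 1 < 0\<close>, in which the bound for \<open>K\<close> is void and the
    \<open>n1\<close> sign changes of \<open>P\<close> are more than are asked for.\<close>
  define k where "k = nat (l + 1)"
  have I: "open I" "is_interval I" "I \<noteq> {}" and J: "open J" "is_interval J" "J \<noteq> {}"
    using assms(1,2) einterval_nonempty[of a b] einterval_nonempty[of c d]
    by (auto simp: I_def J_def is_interval_einterval)
  have IJ: "I \<inter> J = {}" using assms(3) by (simp add: I_def J_def)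
  have away: "z \<notin> closure I" "z \<notin> I" if "z \<in> J" for z
    using open_Int_closure_eq_empty[OF J(1), of I] IJ that by auto
  have integral_I: "(LBINT x=a..b. f x) = (LINT x:I|lborel. f x)" for f :: "real \<Rightarrow> real"
    using assms(1) by (simp add: interval_lebesgue_integral_def I_def less_imp_le)
  have integral_J: "(LBINT x=c..d. f x) = (LINT x:J|lborel. f x)" for f :: "real \<Rightarrow> real"
    using assms(2) by (simp add: interval_lebesgue_integral_def J_def less_imp_le)
  have transform: "cauchy_transform a b w1 P = K"
    by (rule ext) (simp add: cauchy_transform_def integral_I K_def)

  have int1: "set_integrable lborel I (\<lambda>x. x ^ j * w1 x)"
    and int2: "set_integrable lborel I (\<lambda>x. x ^ j * w2 x)" for j
    using assms(1,4,5)
    by (auto simp: semiclassical_weight_def weight_def interval_lebesgue_integrable_def I_def)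
  have w1: "continuous_on I w1" "\<forall>x\<in>I. 0 < w1 x"
  proof -
    obtain A B where AB: "log_deriv_quotient I w1 B A"
      using assms(4) by (auto simp: semiclassical_weight_def I_def)
    then show "continuous_on I w1"
      by (auto simp: log_deriv_quotient_def intro!: continuous_at_imp_continuous_on differentiable_imp_continuous_within)
    have "\<forall>x\<in>I. 0 \<le> w1 x" using assms(4) by (auto simp: semiclassical_weight_def weight_def I_def)
    with AB show "\<forall>x\<in>I. 0 < w1 x" by (auto simp: log_deriv_quotient_def less_le)
  qed
  have u: "continuous_on I u" "\<forall>x\<in>I. u x \<noteq> 0"
    using assms(10)
    by (auto simp: semiclassical_function_def log_deriv_quotient_def I_def
        intro!: continuous_at_imp_continuous_on differentiable_imp_continuous_within)
  have u_eq: "u x = (LINT t:J|lborel. U t / (x - t))" if "x \<in> I" for x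
    using assms(9) that by (simp add: integral_J I_def)
  have U: "continuous_on J U" "\<forall>t\<in>J. 0 \<le> U t" using assms(6,7) by (auto simp: J_def)
  have intU: "\<forall>x\<in>I. set_integrable lborel J (\<lambda>t. U t / (x - t))"
    using assms(2,8) by (auto simp: interval_lebesgue_integrable_def I_def J_def)
  have Q: "\<forall>x\<in>I. poly Q x \<noteq> 0" "\<forall>x\<in>J. poly Q x \<noteq> 0" using assms(11) by (auto simp: I_def J_def)
  have contQ: "continuous_on S (poly Q)" for S by (intro continuous_at_imp_continuous_on) simp
  have P: "P \<noteq> 0" using assms(13) by (auto simp: hermite_pade_poly_def)
  have orth1: "(LINT x:I|lborel. x ^ j * (poly P x * w1 x)) = 0" if "j < n1" for j
    using assms(13) that by (simp add: hermite_pade_poly_def orthogonal_exactly_def integral_I mult_ac)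
  have orth2: "(LINT x:I|lborel. x ^ j * (poly P x * w2 x)) = 0" if "j < n2" for j
    using assms(13) that by (simp add: hermite_pade_poly_def orthogonal_exactly_def integral_I mult_ac)
  have intP: "set_integrable lborel I (\<lambda>x. x ^ j * (poly P x * w x))"
    if "\<And>i. set_integrable lborel I (\<lambda>x. x ^ i * w x)" for j w
    using set_integrable_poly_times(1)[of "Suc (degree (monom 1 j * P))" lborel I w "monom 1 j * P", OF that]
    by (simp add: poly_monom mult_ac)
  have intPw1: "set_integrable lborel I (\<lambda>x. poly P x * w1 x)"
    using intP[OF int1, of 0] by simp
  have contK: "continuous_on J K"
    unfolding K_def by (rule continuous_on_cauchy_integral[OF intPw1 J(1) IJ])

  \<comment> \<open>\<open>Q u\<close> is continuous without zeros on an interval, so the absolute value in \<open>w2\<close> is a sign.\<close>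
  obtain \<epsilon> where \<epsilon>: "\<epsilon> * \<epsilon> = (1::real)" "\<And>x. x \<in> I \<Longrightarrow> \<bar>poly Q x * u x\<bar> = \<epsilon> * (poly Q x * u x)"
  proof -
    obtain y where y: "y \<in> I" using I(3) by blast
    have pos: "0 < (poly Q x * u x) * (poly Q y * u y)" if "x \<in> I" for x
      using that y u Q(1)
      by (intro nonvanishing_imp_constant_sign[OF I(2), of "\<lambda>x. poly Q x * u x"] continuous_on_mult contQ) auto
    show thesis
    proof (rule that[of "sgn (poly Q y * u y)"])
      show "sgn (poly Q y * u y) * sgn (poly Q y * u y) = 1"
        using pos[OF y] by (auto simp: sgn_if)
      fix x assume "x \<in> I"
      have "\<bar>p\<bar> = sgn q * p" if "0 < p * q" for p q :: real
        using that by (auto simp: zero_less_mult_iff)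
      then show "\<bar>poly Q x * u x\<bar> = sgn (poly Q y * u y) * (poly Q x * u x)"
        using pos[OF \<open>x \<in> I\<close>] by blast
    qed
  qed

  \<comment> \<open>The orthogonality relations against \<open>w2\<close>, transported from \<open>(a, b)\<close> to \<open>(c, d)\<close>\<close>
  have key: "set_integrable lborel J (\<lambda>t. t ^ j * (K t * (U t * poly Q t)))"
    "(LINT t:J|lborel. t ^ j * (K t * (U t * poly Q t))) = 0" if j: "j < k" for j
  proof -
    define R where "R = monom 1 j * Q"
    define h where "h = (\<lambda>x. poly R x * (poly P x * w1 x))"
    have jn: "j < n2" "j + degree Q \<le> n1" using j by (auto simp: k_def l_def)
    have R: "poly R x = x ^ j * poly Q x" for x by (simp add: R_def poly_monom)
    have "degree R \<le> degree (monom (1::real) j) + degree Q" unfolding R_def by (rule degree_mult_le)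
    then have degR: "degree R \<le> n1" using jn(2) by (simp add: degree_monom_eq)
    have conth: "continuous_on I h"
      unfolding h_def by (intro continuous_intros w1)
    have hu: "h x * (LINT t:J|lborel. U t / (x - t)) = \<epsilon> * (x ^ j * (poly P x * w2 x))" if "x \<in> I" for x
    proof -
      have "w2 x = \<epsilon> * (poly Q x * u x) * w1 x"
        using assms(12) \<epsilon>(2)[OF that] that by (simp add: I_def)
      then have "\<epsilon> * (x ^ j * (poly P x * w2 x)) = (\<epsilon> * \<epsilon>) * (x ^ j * poly P x * poly Q x * u x * w1 x)"
        by (simp add: mult_ac)
      also have "\<dots> = h x * u x"
        unfolding \<epsilon>(1) by (simp add: h_def R mult_ac)
      finally show ?thesis using u_eq[OF that] by simp
    qed
    have inth: "set_integrable lborel I (\<lambda>x. h x * (LINT t:J|lborel. U t / (x - t)))"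
      using set_integrable_mult_right[of \<epsilon> lborel I "\<lambda>x. x ^ j * (poly P x * w2 x)"] intP[OF int2]
      by (simp add: hu cong: set_integrable_cong)
    have zero: "(LINT x:I|lborel. h x * (LINT t:J|lborel. U t / (x - t))) = 0"
    proof -
      have "(LINT x:I|lborel. h x * (LINT t:J|lborel. U t / (x - t)))
          = (LINT x:I|lborel. \<epsilon> * (x ^ j * (poly P x * w2 x)))"
        using I(1) hu by (intro set_lebesgue_integral_cong) auto
      then show ?thesis using orth2[OF jn(1)] by simp
    qed
    have inner: "U t * (LINT x:I|lborel. h x / (x - t)) = t ^ j * (K t * (U t * poly Q t))" if "t \<in> J" for t
    proof -
      have "(LINT x:I|lborel. h x / (x - t)) = poly R t * K t"
        unfolding h_def K_def
        using I(1) away[OF that] intP[OF int1] set_integrable_divide_away[OF intPw1] orth1 degR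
        by (intro cauchy_integral_poly_times[where n = n1]) auto
      then show ?thesis by (simp add: R mult_ac)
    qed
    note swap = cauchy_integral_swap[OF I(1) J(1,2) IJ conth U intU inth]
    show "set_integrable lborel J (\<lambda>t. t ^ j * (K t * (U t * poly Q t)))"
      using swap(1) inner by (simp cong: set_integrable_cong)
    have "(LINT t:J|lborel. t ^ j * (K t * (U t * poly Q t)))
        = (LINT t:J|lborel. U t * (LINT x:I|lborel. h x / (x - t)))"
      by (intro set_lebesgue_integral_cong allI impI inner[symmetric]) (simp_all add: J(1))
    then show "(LINT t:J|lborel. t ^ j * (K t * (U t * poly Q t))) = 0"
      using swap(2) zero by simp
  qed

  have nonzero: "\<exists>t\<in>J. K t * (U t * poly Q t) \<noteq> 0"
  proof -
    define V where "V = {t \<in> J. U t \<noteq> 0}"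
    have "open V"
      using continuous_open_preimage[OF U(1) J(1), of "-{0}"] by (simp add: V_def vimage_def Int_def open_Compl)
    moreover have "V \<noteq> {}"
    proof
      assume "V = {}"
      then have U0: "\<forall>t\<in>J. U t = 0" by (auto simp: V_def)
      obtain y where y: "y \<in> I" using I(3) by blast
      have "(LINT t:J|lborel. U t / (y - t)) = (LINT t:J|lborel. 0)"
        using J(1) U0 by (intro set_lebesgue_integral_cong) auto
      then show False using u_eq[OF y] u(2) y by simp
    qed
    ultimately have "infinite V" using finite_imp_not_open by blast
    then have "\<not> V \<subseteq> {z. z \<notin> closure I \<and> K z = 0}"
      using finite_cauchy_zeros[OF I w1 int1 P] finite_subset unfolding K_def by blast
    then show ?thesis using Q(2) away by (auto simp: V_def)
  qed

  have "at_least_sign_changes (int k) (\<lambda>t. K t * (U t * poly Q t)) J"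
    using nonzero key by (intro orthogonal_imp_sign_changes J continuous_on_mult contK U contQ) auto
  then have signs_K: "at_least_sign_changes (int k) K J"
  proof (rule at_least_sign_changes_divide_sign)
    fix x y assume xy: "x \<in> J" "y \<in> J"
    have "0 \<le> (U x * U y) * (poly Q x * poly Q y)"
      using U(2) xy nonvanishing_imp_constant_sign[OF J(2) contQ Q(2) xy] by simp
    then show "0 \<le> U x * poly Q x * (U y * poly Q y)" by (simp add: mult_ac)
  qed
  obtain Z where Z: "finite Z" "card Z = k" "Z \<subseteq> J" "\<forall>z\<in>Z. K z = 0"
    using sign_changes_imp_zeros[OF signs_K contK J(2)] by blast
  have "at_least_sign_changes (int (n1 + card Z)) (poly P) I"
    using Z away by (intro cauchy_zeros_imp_sign_changes[OF I w1 int1 P orth1]) (auto simp: K_def)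
  then have "at_least_sign_changes (int n1 + l + 1) (poly P) I"
    by (rule at_least_sign_changes_mono) (use Z(2) in \<open>simp add: k_def\<close>)
  moreover have "at_least_sign_changes (l + 1) K J"
    using signs_K by (rule at_least_sign_changes_mono) (simp add: k_def)
  ultimately show ?thesis
    by (simp add: transform I_def J_def l_def Let_def)
qed

end
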